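(* Every covariety $\mathcal{C}$ of numerical semigroups is a finite set.
   Context: Let $\mathbb{N}=\{0,1,2,\dots\}$. A numerical semigroup is a subset $S\subseteq\mathbb{N}$ that contains $0$, is closed under addition, and has finite complement $\mathbb{N}\setminus S$. Its multiplicity is $m(S)=\min(S\setminus\{0\})$. A covariety is a nonempty family $\mathcal{C}$ of numerical semigroups such that: (1) $\mathcal{C}$ has a minimum $\Delta(\mathcal{C})=\min(\mathcal{C})$ with respect to set inclusion; (2) if $S,T\in\mathcal{C}$ then $S\cap T\in\mathcal{C}$; (3) if $S\in\mathcal{C}$ and $S\neq\Delta(\mathcal{C})$ then $S\setminus\{m(S)\}\in\mathcal{C}$. *)

theory Defs
  imports Main
begin

definition numerical_semigroup :: "nat set \<Rightarrow> bool" where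
  "numerical_semigroup S \<longleftrightarrow>
     0 \<in> S \<and> (\<forall>x\<in>S. \<forall>y\<in>S. x + y \<in> S) \<and> finite (UNIV - S)"

text \<open>
  The set of nonzero elements of a numerical semigroup is infinite, so its
  minimum is written with \<open>LEAST\<close> (\<open>Min\<close> is specified for finite sets only).
\<close>
definition multiplicity :: "nat set \<Rightarrow> nat" where
  "multiplicity S = (LEAST x. x \<in> S - {0})"

definition is_minimum :: "nat set set \<Rightarrow> nat set \<Rightarrow> bool" where
  "is_minimum C D \<longleftrightarrow> D \<in> C \<and> (\<forall>S\<in>C. D \<subseteq> S)"

text \<open>A minimum is unique by antisymmetry; the value is meaningful only if one exists.\<close>
definition minimum :: "nat set set \<Rightarrow> nat set" where
  "minimum C = (THE D. is_minimum C D)"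

definition covariety :: "nat set set \<Rightarrow> bool" where
  "covariety C \<longleftrightarrow>
     C \<noteq> {} \<and>
     (\<forall>S\<in>C. numerical_semigroup S) \<and>
     (\<exists>D. is_minimum C D) \<and>
     (\<forall>S\<in>C. \<forall>T\<in>C. S \<inter> T \<in> C) \<and>
     (\<forall>S\<in>C. S \<noteq> minimum C \<longrightarrow> S - {multiplicity S} \<in> C)"

end

theory Submission
  imports Defs
begin

text \<open>Every member of \<open>C\<close> lies between the minimum \<open>D\<close> and the set
  of all naturals, so it is determined by which of the finitely many gaps of \<open>D\<close> it
  omits. This leaves at most 2^g members, where g is the number of gaps.\<close>

theorem proposition2p2:
  fixes C :: "nat set set"
  assumes "covariety C"
  shows "finite C"
proof -
  obtain D where D: "D \<in> C" "\<forall>S\<in>C. D \<subseteq> S"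
    using assms by (auto simp: covariety_def is_minimum_def)
  then have "numerical_semigroup D"
    using assms by (simp add: covariety_def)
  then have "finite (Pow (UNIV - D))"
    by (simp add: numerical_semigroup_def)
  \<comment> \<open>Members are infinite sets, so their complements are counted instead:
    \<open>D \<subseteq> S\<close> turns into \<open>- S \<subseteq> UNIV - D\<close>.\<close>
  moreover have "uminus ` C \<subseteq> Pow (UNIV - D)"
    using D(2) by auto
  ultimately have "finite (uminus ` C)"
    by (rule rev_finite_subset)
  then show ?thesis
    \<comment> \<open>Complementation is an involution, so no two members share a
      complement.\<close>
    by (rule finite_imageD) (simp add: inj_on_def)
qed

end
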